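(* Let $p\in\mathbb{N}$ and assume that $\boldsymbol{U}^p$ is nonnegative (i.e. $U_{i,K}^p\ge0$ for all $K\in\mathcal{T}$, $0\le i\le n$). Then any solution $\boldsymbol{U}^{p+1}$ to the scheme is nonnegative. If moreover $\boldsymbol{U}^p$ is positive (i.e. $U_{i,K}^p>0$ for all $K\in\mathcal{T}$, $0\le i\le n$), then any solution $\boldsymbol{U}^{p+1}$ is positive as well.
   Context: Parameters: $n\ge1$; $\Omega\subset\mathbb{R}^d$, $d\in\{1,2,3\}$, a bounded domain; $\varepsilon,\beta>0$; $K_{ij}=K_{ji}>0$ for $0\le i\ne j\le n$. Mesh: $\Omega$ carries an admissible mesh $(\mathcal{T},\mathcal{E},(x_K)_{K\in\mathcal{T}})$. $\mathcal{T}$ is a finite set of non-empty, open, polyhedral, convex, pairwise disjoint cells with $\bigcup_K\overline K=\overline\Omega$. $\mathcal{E}$ is a set of closed faces contained in hyperplanes, of $(d-1)$-dimensional Hausdorff measure $m_\sigma>0$, with pairwise intersections of zero $(d-1)$-measure; $\partial K=\bigcup_{\sigma\in\mathcal{E}_K}\sigma$ with $\mathcal{E}_K\subset\mathcal{E}$, and $\bigcup_K\mathcal{E}_K=\mathcal{E}$; for distinct $K,L$, $\overline K\cap\overline L$ is either a single face, denoted $K|L$, or has zero $(d-1)$-measure. The centers satisfy $x_K\in K$ and $x_L-x_K\perp K|L$. $m_K$ is the Lebesgue measure of $K$; $\mathcal{E}_{\rm int}$ is the set of faces $\sigma=K|L$ and $\mathcal{E}_{K,\rm int}=\mathcal{E}_K\cap\mathcal{E}_{\rm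 int}$; the other faces are exterior (contained in $\partial\Omega$). For $\sigma=K|L$: $\tau_\sigma=m_\sigma/|x_K-x_L|$. For $\boldsymbol{V}=(V_K)_{K\in\mathcal{T}}$ and $\sigma\in\mathcal{E}_K$: $V_{K\sigma}=V_L$ if $\sigma=K|L$, $V_{K\sigma}=V_K$ if $\sigma$ is exterior; $D_{K\sigma}\boldsymbol{V}=V_{K\sigma}-V_K$. Scheme: $\Delta t_p>0$ is the time step between iterates $p$ and $p+1$. Given $\boldsymbol{U}^p=(U_{i,K}^p)_{K\in\mathcal{T},0\le i\le n}$, a solution $\boldsymbol{U}^{p+1}$ satisfies, for all $K\in\mathcal{T}$, $i=0,\dots,n$, $$m_K\frac{U_{i,K}^{p+1}-U_{i,K}^p}{\Delta t_p}+\sum_{\sigma\in\mathcal{E}_{K,\rm int}}J_{i,K\sigma}^{p+1}=0,$$ where, with $\boldsymbol{U}_i=(U_{i,K})_K$, $$J_{i,K\sigma}^{p+1}=-\tau_\sigma\sum_{0\le j\ne i\le n}K_{ij}\big(U_{j,\sigma}^{p+1}D_{K\sigma}\boldsymbol{U}_i^{p+1}-U_{i,\sigma}^{p+1}D_{K\sigma}\boldsymbol{U}_j^{p+1}\big)+\tau_\sigma K_{i0}U_{i,\sigma}^{p+1}U_{0,\sigma}^{p+1}D_{K\sigma}\boldsymbol{W}_0^{p+1/2},\quad i=1,\dots,n,$$ $$J_{0,K\sigma}^{p+1}=-\tau_\sigma\sum_{i=1}^nK_{i0}\big(U_{i,\sigma}^{p+1}D_{K\sigma}\boldsymbol{U}_0^{p+1}-U_{0,\sigma}^{p+1}D_{K\sigma}\boldsymbol{U}_i^{p+1}\big)-\tau_\sigma\sum_{i=1}^nK_{i0}U_{i,\sigma}^{p+1}U_{0,\sigma}^{p+1}D_{K\sigma}\boldsymbol{W}_0^{p+1/2},$$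 $$W_{0,K}^{p+1/2}=-\frac{\varepsilon}{m_K}\sum_{\sigma\in\mathcal{E}_{K,\rm int}}\tau_\sigma D_{K\sigma}\boldsymbol{U}_0^{p+1}+\beta(1-2U_{0,K}^p),$$ and the edge values are $U_{i,\sigma}^{p+1}=0$ if $\min(U_{i,K}^{p+1},U_{i,K\sigma}^{p+1})\le0$; $U_{i,\sigma}^{p+1}=U_{i,K}^{p+1}$ if $0<U_{i,K}^{p+1}=U_{i,K\sigma}^{p+1}$; and $U_{i,\sigma}^{p+1}=\frac{U_{i,K}^{p+1}-U_{i,K\sigma}^{p+1}}{\ln U_{i,K}^{p+1}-\ln U_{i,K\sigma}^{p+1}}$ otherwise. *)

theory Defs
  imports "HOL-Analysis.Analysis"
begin

section \<open>Hausdorff measure\<close>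

text \<open>
  The \<open>s\<close>-dimensional Hausdorff (outer) measure for an integer \<open>s\<close>, normalised by the volume of
  the unit ball of dimension \<open>s\<close>, so that it is the usual area on \<open>s\<close>-dimensional flat pieces
  and the counting measure for \<open>s = 0\<close>. The case distinction makes the empty set cost nothing
  when \<open>s = 0\<close>, where \<open>0 ^ 0 = 1\<close>.
\<close>

definition hausdorff_content :: "nat \<Rightarrow> real \<Rightarrow> 'a::metric_space set \<Rightarrow> ennreal" where
  "hausdorff_content s \<delta> A =
     (INF C \<in> {C :: nat \<Rightarrow> 'a set. A \<subseteq> (\<Union>i. C i) \<and> (\<forall>i. bounded (C i) \<and> diameter (C i) \<le> \<delta>)}.
        \<Sum>i. if C i = {} then 0
            else ennreal (unit_ball_vol (real s) * (diameter (C i) / 2) ^ s))"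

definition hausdorff_measure :: "nat \<Rightarrow> 'a::metric_space set \<Rightarrow> ennreal" where
  "hausdorff_measure s A = (SUP \<delta> \<in> {0<..}. hausdorff_content s \<delta> A)"

definition face_measure :: "'a::euclidean_space set \<Rightarrow> ennreal" where
  "face_measure \<sigma> = hausdorff_measure (DIM('a) - 1) \<sigma>"

section \<open>Admissible meshes\<close>

record 'a mesh =
  cells :: "'a set set"
  faces :: "'a set set"
  cell_faces :: "'a set \<Rightarrow> 'a set set"
  center :: "'a set \<Rightarrow> 'a"

locale admissible_mesh =
  fixes \<Omega> :: "'a::euclidean_space set" and M :: "'a mesh"
  assumes finite_cells: "finite (cells M)"
    and cell_nonempty: "\<And>K. K \<in> cells M \<Longrightarrow> K \<noteq> {}"
    and cell_open: "\<And>K. K \<in> cells M \<Longrightarrow> open K"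
    and cell_convex: "\<And>K. K \<in> cells M \<Longrightarrow> convex K"
    (* the library's polyhedra are closed, the cells are open *)
    and cell_polyhedral: "\<And>K. K \<in> cells M \<Longrightarrow> polyhedron (closure K)"
    and cells_disjoint: "pairwise disjnt (cells M)"
    and cells_cover: "(\<Union>K\<in>cells M. closure K) = closure \<Omega>"
    and face_closed: "\<And>\<sigma>. \<sigma> \<in> faces M \<Longrightarrow> closed \<sigma>"
    and face_in_hyperplane: "\<And>\<sigma>. \<sigma> \<in> faces M \<Longrightarrow> \<exists>a b. a \<noteq> 0 \<and> \<sigma> \<subseteq> {y. a \<bullet> y = b}"
    and face_measure_pos: "\<And>\<sigma>. \<sigma> \<in> faces M \<Longrightarrow> face_measure \<sigma> > 0"
    and faces_null_inter:
      "\<And>\<sigma> \<sigma>'. \<sigma> \<in> faces M \<Longrightarrow> \<sigma>' \<in> faces M \<Longrightarrow> \<sigma> \<noteq> \<sigma>' \<Longrightarrow> face_measure (\<sigma> \<inter> \<sigma>') = 0"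
    and cell_faces_subset: "\<And>K. K \<in> cells M \<Longrightarrow> cell_faces M K \<subseteq> faces M"
    and cell_boundary: "\<And>K. K \<in> cells M \<Longrightarrow> frontier K = \<Union>(cell_faces M K)"
    and faces_eq: "(\<Union>K\<in>cells M. cell_faces M K) = faces M"
    and cells_inter:
      "\<And>K L. K \<in> cells M \<Longrightarrow> L \<in> cells M \<Longrightarrow> K \<noteq> L \<Longrightarrow>
         closure K \<inter> closure L \<in> faces M \<or> face_measure (closure K \<inter> closure L) = 0"
    and exterior_face:
      "\<And>\<sigma>. \<sigma> \<in> faces M \<Longrightarrow>
         \<not> (\<exists>K\<in>cells M. \<exists>L\<in>cells M. K \<noteq> L \<and> \<sigma> = closure K \<inter> closure L) \<Longrightarrow> \<sigma> \<subseteq> frontier \<Omega>"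
    and center_in_cell: "\<And>K. K \<in> cells M \<Longrightarrow> center M K \<in> K"
    and centers_orthogonal:
      "\<And>K L y z. K \<in> cells M \<Longrightarrow> L \<in> cells M \<Longrightarrow> K \<noteq> L \<Longrightarrow> closure K \<inter> closure L \<in> faces M \<Longrightarrow>
         y \<in> closure K \<inter> closure L \<Longrightarrow> z \<in> closure K \<inter> closure L \<Longrightarrow>
         orthogonal (center M L - center M K) (y - z)"

definition interior_faces :: "'a::euclidean_space mesh \<Rightarrow> 'a set set" where
  "interior_faces M =
     {\<sigma> \<in> faces M. \<exists>K\<in>cells M. \<exists>L\<in>cells M. K \<noteq> L \<and> \<sigma> = closure K \<inter> closure L}"

definition cell_interior_faces :: "'a::euclidean_space mesh \<Rightarrow> 'a set \<Rightarrow> 'a set set" where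
  "cell_interior_faces M K = cell_faces M K \<inter> interior_faces M"

definition is_neighbor :: "'a::euclidean_space mesh \<Rightarrow> 'a set \<Rightarrow> 'a set \<Rightarrow> 'a set \<Rightarrow> bool" where
  "is_neighbor M K \<sigma> L \<longleftrightarrow> L \<in> cells M \<and> L \<noteq> K \<and> \<sigma> = closure K \<inter> closure L"

text \<open>
  For \<open>\<sigma> = K|L\<close> the cell \<open>L\<close> is determined by \<open>K\<close> and \<open>\<sigma>\<close>: three disjoint open convex sets
  cannot share a part of a hyperplane of positive \<open>(d-1)\<close>-measure in their boundaries.
\<close>

definition neighbor :: "'a::euclidean_space mesh \<Rightarrow> 'a set \<Rightarrow> 'a set \<Rightarrow> 'a set" where
  "neighbor M K \<sigma> = (SOME L. is_neighbor M K \<sigma> L)"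

text \<open>
  The transmissibility of \<open>\<sigma> = K|L\<close>, computed from the side of \<open>K\<close>; it is symmetric in \<open>K\<close> and
  \<open>L\<close>, and it is only used for interior faces. As a bounded subset of a hyperplane, \<open>\<sigma>\<close> has
  finite measure.
\<close>

definition transm :: "'a::euclidean_space mesh \<Rightarrow> 'a set \<Rightarrow> 'a set \<Rightarrow> real" where
  "transm M K \<sigma> = enn2real (face_measure \<sigma>) / dist (center M K) (center M (neighbor M K \<sigma>))"

definition mirror_val :: "'a::euclidean_space mesh \<Rightarrow> ('a set \<Rightarrow> real) \<Rightarrow> 'a set \<Rightarrow> 'a set \<Rightarrow> real"
  where
  "mirror_val M V K \<sigma> = (if \<exists>L. is_neighbor M K \<sigma> L then V (neighbor M K \<sigma>) else V K)"

definition face_diff :: "'a::euclidean_space mesh \<Rightarrow> ('a set \<Rightarrow> real) \<Rightarrow> 'a set \<Rightarrow> 'a set \<Rightarrow> real"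
  where
  "face_diff M V K \<sigma> = mirror_val M V K \<sigma> - V K"

section \<open>The scheme\<close>

definition log_mean :: "real \<Rightarrow> real \<Rightarrow> real" where
  "log_mean a b =
     (if min a b \<le> 0 then 0 else if a = b then a else (a - b) / (ln a - ln b))"

definition edge_val :: "'a::euclidean_space mesh \<Rightarrow> ('a set \<Rightarrow> real) \<Rightarrow> 'a set \<Rightarrow> 'a set \<Rightarrow> real"
  where
  "edge_val M V K \<sigma> = log_mean (V K) (mirror_val M V K \<sigma>)"

text \<open>
  Species are indexed by \<open>{0..n}\<close>; \<open>U\<close> stands for the iterate at step \<open>p\<close> and \<open>V\<close> for the one at
  step \<open>p + 1\<close>. The discrete potential treats the second-order term implicitly and the concave
  part of the energy explicitly.
\<close>

definition potential ::
  "'a::euclidean_space mesh \<Rightarrow> real \<Rightarrow> real \<Rightarrow> (nat \<Rightarrow> 'a set \<Rightarrow> real) \<Rightarrow> (nat \<Rightarrow> 'a set \<Rightarrow> real)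
     \<Rightarrow> 'a set \<Rightarrow> real" where
  "potential M \<epsilon> \<beta> U V K =
     - (\<epsilon> / measure lebesgue K)
         * (\<Sum>\<sigma>\<in>cell_interior_faces M K. transm M K \<sigma> * face_diff M (V 0) K \<sigma>)
     + \<beta> * (1 - 2 * U 0 K)"

definition flux ::
  "'a::euclidean_space mesh \<Rightarrow> nat \<Rightarrow> (nat \<Rightarrow> nat \<Rightarrow> real) \<Rightarrow> real \<Rightarrow> real
     \<Rightarrow> (nat \<Rightarrow> 'a set \<Rightarrow> real) \<Rightarrow> (nat \<Rightarrow> 'a set \<Rightarrow> real) \<Rightarrow> nat \<Rightarrow> 'a set \<Rightarrow> 'a set \<Rightarrow> real" where
  "flux M n \<kappa> \<epsilon> \<beta> U V i K \<sigma> =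
     (if i = 0 then
        - transm M K \<sigma> *
            (\<Sum>j\<in>{1..n}. \<kappa> j 0 * (edge_val M (V j) K \<sigma> * face_diff M (V 0) K \<sigma>
                                 - edge_val M (V 0) K \<sigma> * face_diff M (V j) K \<sigma>))
        - transm M K \<sigma> *
            (\<Sum>j\<in>{1..n}. \<kappa> j 0 * edge_val M (V j) K \<sigma> * edge_val M (V 0) K \<sigma>
                         * face_diff M (potential M \<epsilon> \<beta> U V) K \<sigma>)
      else
        - transm M K \<sigma> *
            (\<Sum>j\<in>{0..n} - {i}. \<kappa> i j * (edge_val M (V j) K \<sigma> * face_diff M (V i) K \<sigma>
                                       - edge_val M (V i) K \<sigma> * face_diff M (V j) K \<sigma>))
        + transm M K \<sigma> * \<kappa> i 0 * edge_val M (V i) K \<sigma> * edge_val M (V 0) K \<sigma>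
            * face_diff M (potential M \<epsilon> \<beta> U V) K \<sigma>)"

definition scheme_solution ::
  "'a::euclidean_space mesh \<Rightarrow> nat \<Rightarrow> (nat \<Rightarrow> nat \<Rightarrow> real) \<Rightarrow> real \<Rightarrow> real \<Rightarrow> real
     \<Rightarrow> (nat \<Rightarrow> 'a set \<Rightarrow> real) \<Rightarrow> (nat \<Rightarrow> 'a set \<Rightarrow> real) \<Rightarrow> bool" where
  "scheme_solution M n \<kappa> \<epsilon> \<beta> \<Delta>t U V \<longleftrightarrow>
     (\<forall>K\<in>cells M. \<forall>i\<in>{0..n}.
        measure lebesgue K * ((V i K - U i K) / \<Delta>t)
          + (\<Sum>\<sigma>\<in>cell_interior_faces M K. flux M n \<kappa> \<epsilon> \<beta> U V i K \<sigma>) = 0)"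

definition nonneg_state :: "'a mesh \<Rightarrow> nat \<Rightarrow> (nat \<Rightarrow> 'a set \<Rightarrow> real) \<Rightarrow> bool" where
  "nonneg_state M n U \<longleftrightarrow> (\<forall>K\<in>cells M. \<forall>i\<in>{0..n}. U i K \<ge> 0)"

definition pos_state :: "'a mesh \<Rightarrow> nat \<Rightarrow> (nat \<Rightarrow> 'a set \<Rightarrow> real) \<Rightarrow> bool" where
  "pos_state M n U \<longleftrightarrow> (\<forall>K\<in>cells M. \<forall>i\<in>{0..n}. U i K > 0)"

end

theory Submission
  imports Defs
begin

text \<open>
  Fix a species \<open>i\<close> and a cell \<open>K\<close> at which \<open>V i\<close> attains its minimum over the mesh, and suppose
  that this minimum is not positive. The edge value \<open>log_mean\<close> is truncated to \<open>0\<close> as soon as one of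
  its arguments is not positive, so the edge values of species \<open>i\<close> vanish on every face of \<open>K\<close>. With
  them disappear all terms of the flux of species \<open>i\<close> whose sign is unknown: the cross-diffusion
  terms, driven by the differences of the other species, and the drift, driven by the potential.
  What remains is plain diffusion with nonnegative coefficients, and at a minimum it can only let mass
  flow into \<open>K\<close> (\<open>flux_nonpos_at_nonpos_minimum\<close>). The balance in \<open>K\<close> then says that
  \<open>V i K \<ge> U i K\<close> (\<open>scheme_increases_nonpos_minimum\<close>).

  Both halves of the theorem follow from this inequality. If \<open>U\<close> is nonnegative, a negative
  minimum of \<open>V i\<close> is impossible; if \<open>U\<close> is positive, a minimum that is negative or zero is impossible.
\<close>

lemma log_mean_nonneg: "log_mean a b \<ge> 0"
proof -
  have "(a - b) / (ln a - ln b) \<ge> 0" if "a > 0" "b > 0"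
    using that by (cases "a \<le> b") (auto simp: zero_le_divide_iff)
  then show ?thesis
    by (auto simp: log_mean_def)
qed

lemma edge_val_nonneg: "edge_val M f K \<sigma> \<ge> 0"
  by (simp add: edge_val_def log_mean_nonneg)

lemma edge_val_eq_0: "f K \<le> 0 \<Longrightarrow> edge_val M f K \<sigma> = 0"
  by (simp add: edge_val_def log_mean_def)

lemma transm_nonneg: "transm M K \<sigma> \<ge> 0"
  by (simp add: transm_def)

lemma face_diff_nonneg_at_minimum:
  assumes "\<And>L. L \<in> cells M \<Longrightarrow> f K \<le> f L"
  shows "face_diff M f K \<sigma> \<ge> 0"
proof (cases "\<exists>L. is_neighbor M K \<sigma> L")
  case True
  then have "is_neighbor M K \<sigma> (neighbor M K \<sigma>)"
    unfolding neighbor_def by (rule someI_ex)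
  with True assms show ?thesis
    by (simp add: face_diff_def mirror_val_def is_neighbor_def)
qed (simp add: face_diff_def mirror_val_def)

text \<open>
  Since \<open>V i K\<close> is not positive, the edge values of species \<open>i\<close> vanish and the flux reduces to
  \<open>- \<tau> (\<Sum>j. \<kappa> i j V\<^sub>j D V\<^sub>i)\<close>, with \<open>V\<^sub>j\<close> the edge values of the other species and \<open>D\<close> the
  difference across the face. Every factor in this sum is nonnegative at a minimum.
\<close>

lemma flux_nonpos_at_nonpos_minimum:
  assumes \<kappa>: "\<And>j. j \<in> {0..n} \<Longrightarrow> j \<noteq> i \<Longrightarrow> \<kappa> i j \<ge> 0 \<and> \<kappa> j i \<ge> 0"
    and nonpos: "V i K \<le> 0"
    and minimum: "\<And>L. L \<in> cells M \<Longrightarrow> V i K \<le> V i L"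
  shows "flux M n \<kappa> \<epsilon> \<beta> U V i K \<sigma> \<le> 0"
proof (cases "i = 0")
  case True
  have "(\<Sum>j\<in>{1..n}. \<kappa> j 0 * (edge_val M (V j) K \<sigma> * face_diff M (V 0) K \<sigma>)) \<ge> 0"
    using \<kappa> True minimum
    by (intro sum_nonneg mult_nonneg_nonneg edge_val_nonneg face_diff_nonneg_at_minimum) auto
  then show ?thesis
    using True nonpos by (simp add: flux_def edge_val_eq_0 transm_nonneg)
next
  case False
  have "(\<Sum>j\<in>{0..n} - {i}. \<kappa> i j * (edge_val M (V j) K \<sigma> * face_diff M (V i) K \<sigma>)) \<ge> 0"
    using \<kappa> minimum
    by (intro sum_nonneg mult_nonneg_nonneg edge_val_nonneg face_diff_nonneg_at_minimum) auto
  then show ?thesis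
    using False nonpos by (simp add: flux_def edge_val_eq_0 transm_nonneg)
qed

text \<open>
  Boundedness of the domain matters because \<open>measure\<close> is \<open>0\<close> on sets of infinite volume. The time
  derivative would then drop out of the balance, which would say nothing about \<open>V i K\<close>.
\<close>

lemma (in admissible_mesh) cell_measure_pos:
  assumes "bounded \<Omega>" and K: "K \<in> cells M"
  shows "measure lebesgue K > 0"
proof -
  have "K \<subseteq> closure \<Omega>"
    using cells_cover closure_subset K by blast
  then have "bounded K"
    using \<open>bounded \<Omega>\<close> bounded_closure bounded_subset by blast
  then have "K \<in> lmeasurable"
    using cell_open[OF K] by (rule lmeasurable_open)
  moreover have "\<not> negligible K"
    using open_not_negligible cell_open cell_nonempty K by blast
  ultimately show ?thesis
    by (simp add: negligible_iff_measure zero_less_measure_iff)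
qed

lemma (in admissible_mesh) scheme_increases_nonpos_minimum:
  assumes "bounded \<Omega>" and "\<tau> > 0"
    and \<kappa>: "\<And>j. j \<in> {0..n} \<Longrightarrow> j \<noteq> i \<Longrightarrow> \<kappa> i j \<ge> 0 \<and> \<kappa> j i \<ge> 0"
    and solution: "scheme_solution M n \<kappa> \<epsilon> \<beta> \<tau> U V"
    and "i \<in> {0..n}" and K: "K \<in> cells M"
    and "V i K \<le> 0" and "\<And>L. L \<in> cells M \<Longrightarrow> V i K \<le> V i L"
  shows "U i K \<le> V i K"
proof -
  have "(\<Sum>\<sigma>\<in>cell_interior_faces M K. flux M n \<kappa> \<epsilon> \<beta> U V i K \<sigma>) \<le> 0"
    using assms by (intro sum_nonpos flux_nonpos_at_nonpos_minimum) auto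
  moreover have "measure lebesgue K * ((V i K - U i K) / \<tau>)
      + (\<Sum>\<sigma>\<in>cell_interior_faces M K. flux M n \<kappa> \<epsilon> \<beta> U V i K \<sigma>) = 0"
    using solution \<open>i \<in> {0..n}\<close> K by (simp add: scheme_solution_def)
  ultimately have "measure lebesgue K * ((V i K - U i K) / \<tau>) \<ge> 0"
    by linarith
  then show ?thesis
    using cell_measure_pos[OF \<open>bounded \<Omega>\<close> K] \<open>\<tau> > 0\<close>
    by (simp add: zero_le_mult_iff zero_le_divide_iff)
qed

theorem lemma4p4:
  fixes \<Omega> :: "'a::euclidean_space set" and M :: "'a mesh"
    and n p :: nat and \<kappa> :: "nat \<Rightarrow> nat \<Rightarrow> real" and \<epsilon> \<beta> :: real
    and \<Delta>t :: "nat \<Rightarrow> real" and U :: "nat \<Rightarrow> nat \<Rightarrow> 'a set \<Rightarrow> real"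
  assumes "DIM('a) \<in> {1, 2, 3}"
    and "open \<Omega>" and "connected \<Omega>" and "\<Omega> \<noteq> {}" and "bounded \<Omega>"
    and "admissible_mesh \<Omega> M"
    and "n \<ge> 1" and "\<epsilon> > 0" and "\<beta> > 0"
    and "\<forall>i\<in>{0..n}. \<forall>j\<in>{0..n}. i \<noteq> j \<longrightarrow> \<kappa> i j = \<kappa> j i \<and> \<kappa> i j > 0"
    and "\<forall>q. \<Delta>t q > 0"
    and "nonneg_state M n (U p)"
  shows "(\<forall>V. scheme_solution M n \<kappa> \<epsilon> \<beta> (\<Delta>t p) (U p) V \<longrightarrow> nonneg_state M n V) \<and>
         (pos_state M n (U p) \<longrightarrow>
            (\<forall>V. scheme_solution M n \<kappa> \<epsilon> \<beta> (\<Delta>t p) (U p) V \<longrightarrow> pos_state M n V))"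
proof -
  interpret admissible_mesh \<Omega> M by fact
  have minimum: "\<exists>L\<in>cells M. V i L \<le> V i K \<and> (V i L \<le> 0 \<longrightarrow> U p i L \<le> V i L)"
    if "scheme_solution M n \<kappa> \<epsilon> \<beta> (\<Delta>t p) (U p) V" "i \<in> {0..n}" "K \<in> cells M" for V i K
  proof -
    obtain L where L: "L \<in> cells M" "\<And>L'. L' \<in> cells M \<Longrightarrow> V i L \<le> V i L'"
      using finite_cells \<open>K \<in> cells M\<close>
      by (metis arg_min_least arg_min_if_finite(1) empty_iff)
    have "\<kappa> i j \<ge> 0 \<and> \<kappa> j i \<ge> 0" if "j \<in> {0..n}" "j \<noteq> i" for j
      using assms(10) \<open>i \<in> {0..n}\<close> that by (metis less_imp_le)
    then have "U p i L \<le> V i L" if "V i L \<le> 0"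
      using scheme_increases_nonpos_minimum[of "\<Delta>t p" n i \<kappa> \<epsilon> \<beta> "U p" V L]
        assms(5,11) \<open>scheme_solution _ _ _ _ _ _ _ V\<close> \<open>i \<in> {0..n}\<close> L that by blast
    with L \<open>K \<in> cells M\<close> show ?thesis
      by blast
  qed
  show ?thesis
  proof (intro conjI impI allI)
    fix V
    assume V: "scheme_solution M n \<kappa> \<epsilon> \<beta> (\<Delta>t p) (U p) V"
    show "nonneg_state M n V"
      unfolding nonneg_state_def
    proof (intro ballI)
      fix K i assume "K \<in> cells M" and "i \<in> {0..n}"
      with minimum[OF V] obtain L
        where "L \<in> cells M" "V i L \<le> V i K" "V i L \<le> 0 \<longrightarrow> U p i L \<le> V i L"
        by blast
      moreover have "U p i L \<ge> 0"
        using assms(12) \<open>L \<in> cells M\<close> \<open>i \<in> {0..n}\<close> by (simp add: nonneg_state_def)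
      ultimately show "V i K \<ge> 0"
        by linarith
    qed
  next
    fix V
    assume U: "pos_state M n (U p)"
      and V: "scheme_solution M n \<kappa> \<epsilon> \<beta> (\<Delta>t p) (U p) V"
    show "pos_state M n V"
      unfolding pos_state_def
    proof (intro ballI)
      fix K i assume "K \<in> cells M" and "i \<in> {0..n}"
      with minimum[OF V] obtain L
        where "L \<in> cells M" "V i L \<le> V i K" "V i L \<le> 0 \<longrightarrow> U p i L \<le> V i L"
        by blast
      moreover have "U p i L > 0"
        using U \<open>L \<in> cells M\<close> \<open>i \<in> {0..n}\<close> by (simp add: pos_state_def)
      ultimately show "V i K > 0"
        by linarith
    qed
  qed
qed

end
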